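(* Let $X$ be a finite set with $n\geq 1$ elements. Then: (1) If $S$ is a commutative inverse subsemigroup of $\mathcal{I}(X)$, then $|S|\leq 2^n$. (2) The semilattice $E(\mathcal{I}(X))$ of idempotents of $\mathcal{I}(X)$ is the unique commutative inverse subsemigroup of $\mathcal{I}(X)$ of order $2^n$.
   Context: For a finite set $X$, $\mathcal{I}(X)$ is the symmetric inverse semigroup on $X$: all partial injective transformations of $X$ (injective functions whose domain and image are subsets of $X$) under composition of partial functions. A semigroup $S$ is an inverse semigroup if every $a\in S$ has exactly one $a'\in S$ with $a=aa'a$ and $a'=a'aa'$. An inverse subsemigroup of $\mathcal{I}(X)$ is a subsemigroup that is itself an inverse semigroup. $E(\mathcal{I}(X))$ is the set of elements $\varepsilon\in\mathcal{I}(X)$ with $\varepsilon\varepsilon=\varepsilon$ (that is, partial identity maps on subsets of $X$). *)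

theory Defs
  imports Main
begin

text \<open>
  Partial transformations are maps of type \<open>'a \<rightharpoonup> 'a\<close>; outside its domain a map
  has the value \<open>None\<close>, so equality of maps is equality of partial functions.
\<close>

definition sym_inv_semigroup :: "'a set \<Rightarrow> ('a \<rightharpoonup> 'a) set" where
  "sym_inv_semigroup X = {f. dom f \<subseteq> X \<and> ran f \<subseteq> X \<and> inj_on f (dom f)}"

text \<open>Semigroups are given by a binary operation and a carrier closed under it.\<close>

definition semigroup_on :: "('b \<Rightarrow> 'b \<Rightarrow> 'b) \<Rightarrow> 'b set \<Rightarrow> bool" where
  "semigroup_on m S \<longleftrightarrow>
     (\<forall>a\<in>S. \<forall>b\<in>S. m a b \<in> S) \<and>
     (\<forall>a\<in>S. \<forall>b\<in>S. \<forall>c\<in>S. m (m a b) c = m a (m b c))"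

definition inverse_semigroup_on :: "('b \<Rightarrow> 'b \<Rightarrow> 'b) \<Rightarrow> 'b set \<Rightarrow> bool" where
  "inverse_semigroup_on m S \<longleftrightarrow>
     semigroup_on m S \<and>
     (\<forall>a\<in>S. \<exists>!a'. a' \<in> S \<and> a = m (m a a') a \<and> a' = m (m a' a) a')"

definition commutative_on :: "('b \<Rightarrow> 'b \<Rightarrow> 'b) \<Rightarrow> 'b set \<Rightarrow> bool" where
  "commutative_on m S \<longleftrightarrow> (\<forall>a\<in>S. \<forall>b\<in>S. m a b = m b a)"

definition idempotents_on :: "('b \<Rightarrow> 'b \<Rightarrow> 'b) \<Rightarrow> 'b set \<Rightarrow> 'b set" where
  "idempotents_on m S = {e \<in> S. m e e = e}"

text \<open>
  \<open>f \<circ>\<^sub>m g\<close> applies \<open>g\<close> first. Reversing the order of composition would not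
  affect which subsets are commutative inverse subsemigroups, nor which elements are idempotent.
\<close>

definition comm_inverse_subsemigroup :: "'a set \<Rightarrow> ('a \<rightharpoonup> 'a) set \<Rightarrow> bool" where
  "comm_inverse_subsemigroup X S \<longleftrightarrow>
     S \<subseteq> sym_inv_semigroup X \<and>
     inverse_semigroup_on (\<circ>\<^sub>m) S \<and>
     commutative_on (\<circ>\<^sub>m) S"

end

(* Idea: by commutativity, an element f of a commutative inverse subsemigroup S is determined by
   its value at one representative of each S-orbit, since f (h r) = h (f r) for all h in S.
   As f preserves orbits, f is therefore determined by the set of its values at the
   representatives, a subset of X meeting every orbit in at most one point. This gives
   card S \<le> 2 ^ n; if equality holds, then X itself arises as such a set, so all orbits are
   singletons and S consists of partial identities. *)
theory Submission
  imports Defs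
begin

lemma restrict_Some_comp: "(Some |` A) \<circ>\<^sub>m (Some |` B) = Some |` (A \<inter> B)"
  by (auto simp: fun_eq_iff map_comp_def restrict_map_def)

text \<open>Identifying an idempotent with its domain turns composition into intersection and
  reduces counting idempotents to counting subsets of \<open>X\<close>.\<close>

lemma idempotents_sym_inv_semigroup:
  "idempotents_on (\<circ>\<^sub>m) (sym_inv_semigroup X) = (\<lambda>A. Some |` A) ` Pow X"
proof (intro equalityI subsetI)
  fix e assume "e \<in> idempotents_on (\<circ>\<^sub>m) (sym_inv_semigroup X)"
  then have dom: "dom e \<subseteq> X" and inj: "inj_on e (dom e)" and idem: "e \<circ>\<^sub>m e = e"
    by (auto simp: idempotents_on_def sym_inv_semigroup_def)
  have "y = x" if "e x = Some y" for x y
  proof -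
    \<comment> \<open>Thus \<open>e\<close> takes the same value at \<open>x\<close> and at
      \<open>y\<close>, and injectivity applies.\<close>
    have "e y = Some y" using fun_cong[OF idem, of x] that by (simp add: map_comp_def)
    then show ?thesis using inj that by (metis domI inj_onD)
  qed
  then have "e = Some |` dom e"
    by (auto simp: fun_eq_iff restrict_map_def)
  then show "e \<in> (\<lambda>A. Some |` A) ` Pow X" using dom by blast
next
  fix e assume "e \<in> (\<lambda>A. Some |` A) ` Pow X"
  then show "e \<in> idempotents_on (\<circ>\<^sub>m) (sym_inv_semigroup X)"
    by (auto simp: idempotents_on_def sym_inv_semigroup_def restrict_Some_comp inj_on_def
        restrict_map_def ran_def split: if_splits)
qed

lemma comm_inverse_subsemigroup_idempotents:
  "comm_inverse_subsemigroup X (idempotents_on (\<circ>\<^sub>m) (sym_inv_semigroup X))"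
proof -
  let ?E = "idempotents_on (\<circ>\<^sub>m) (sym_inv_semigroup X)"
  have "semigroup_on (\<circ>\<^sub>m) ?E"
    unfolding semigroup_on_def idempotents_sym_inv_semigroup
    by (auto simp: restrict_Some_comp Int_assoc)
  moreover have "commutative_on (\<circ>\<^sub>m) ?E"
    unfolding commutative_on_def idempotents_sym_inv_semigroup
    by (auto simp: restrict_Some_comp Int_commute)
  moreover have "\<exists>!b. b \<in> ?E \<and> a = a \<circ>\<^sub>m b \<circ>\<^sub>m a \<and> b = b \<circ>\<^sub>m a \<circ>\<^sub>m b" if a: "a \<in> ?E" for a
  proof (intro ex1I[of _ a])
    show "a \<in> ?E \<and> a = a \<circ>\<^sub>m a \<circ>\<^sub>m a \<and> a = a \<circ>\<^sub>m a \<circ>\<^sub>m a"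
      using a by (simp add: idempotents_on_def)
  next
    fix b assume b: "b \<in> ?E \<and> a = a \<circ>\<^sub>m b \<circ>\<^sub>m a \<and> b = b \<circ>\<^sub>m a \<circ>\<^sub>m b"
    obtain A where A: "a = Some |` A"
      using a unfolding idempotents_sym_inv_semigroup by blast
    obtain B where B: "b = Some |` B"
      using b unfolding idempotents_sym_inv_semigroup by blast
    \<comment> \<open>Both products are the partial identity on the intersection of \<open>A\<close>
      and \<open>B\<close>, while the two equations assumed of \<open>b\<close> say that they equal
      \<open>a\<close> and \<open>b\<close> respectively.\<close>
    have "a \<circ>\<^sub>m b \<circ>\<^sub>m a = b \<circ>\<^sub>m a \<circ>\<^sub>m b"
      unfolding A B restrict_Some_comp by (simp add: Int_ac)
    then show "b = a" using b by metis
  qed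
  moreover have "?E \<subseteq> sym_inv_semigroup X"
    by (auto simp: idempotents_on_def)
  ultimately show ?thesis
    unfolding comm_inverse_subsemigroup_def inverse_semigroup_on_def by blast
qed

lemma card_idempotents_sym_inv_semigroup:
  assumes "finite X"
  shows "card (idempotents_on (\<circ>\<^sub>m) (sym_inv_semigroup X)) = 2 ^ card X"
proof -
  have "A = B" if "Some |` A = Some |` B" for A B :: "'a set"
    using arg_cong[OF that, of dom] by simp
  then have "inj_on (\<lambda>A. Some |` A) (Pow X)" by (auto intro!: inj_onI)
  then show ?thesis
    by (simp add: idempotents_sym_inv_semigroup card_image card_Pow assms)
qed

text \<open>Inserting \<open>x\<close> keeps the relation reflexive at points where no element of
  \<open>S\<close> is defined; such a point forms an orbit by itself.\<close>

definition orbit :: "('a \<rightharpoonup> 'a) set \<Rightarrow> 'a \<Rightarrow> 'a set" where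
  "orbit S x = insert x {y. \<exists>f\<in>S. f x = Some y}"

text \<open>The choice depends only on the set \<open>orbit S x\<close>, so points with the same
  orbit receive the same representative.\<close>

definition orbit_rep :: "('a \<rightharpoonup> 'a) set \<Rightarrow> 'a \<Rightarrow> 'a" where
  "orbit_rep S x = (SOME y. y \<in> orbit S x)"

lemma self_in_orbit: "x \<in> orbit S x"
  by (simp add: orbit_def)

lemma orbit_rep_in_orbit: "orbit_rep S x \<in> orbit S x"
  unfolding orbit_rep_def using self_in_orbit by (rule someI)

lemma comm_inverse_subsemigroup_comp:
  assumes "comm_inverse_subsemigroup X S" "f \<in> S" "g \<in> S"
  shows "f \<circ>\<^sub>m g \<in> S"
  using assms
  by (simp add: comm_inverse_subsemigroup_def inverse_semigroup_on_def semigroup_on_def)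

lemma comm_inverse_subsemigroup_comm:
  assumes "comm_inverse_subsemigroup X S" "f \<in> S" "g \<in> S"
  shows "f \<circ>\<^sub>m g = g \<circ>\<^sub>m f"
  using assms by (simp add: comm_inverse_subsemigroup_def commutative_on_def)

text \<open>Evaluating \<open>f = f g f\<close> at \<open>x\<close> shows that \<open>f\<close>
  sends \<open>g y\<close> to \<open>y = f x\<close>, so injectivity forces \<open>g y = x\<close>.
  This makes the orbit relation symmetric.\<close>

lemma comm_inverse_subsemigroup_inverse:
  assumes S: "comm_inverse_subsemigroup X S" and f: "f \<in> S" and fx: "f x = Some y"
  shows "\<exists>g\<in>S. g y = Some x"
proof -
  obtain g where g: "g \<in> S" "f = f \<circ>\<^sub>m g \<circ>\<^sub>m f"
    using S f unfolding comm_inverse_subsemigroup_def inverse_semigroup_on_def by metis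
  have "(f \<circ>\<^sub>m g) y = Some y"
    using fun_cong[OF g(2), of x] fx by (simp add: map_comp_def)
  then obtain z where z: "g y = Some z" "f z = Some y"
    by (auto simp: map_comp_Some_iff)
  have "inj_on f (dom f)"
    using S f by (auto simp: comm_inverse_subsemigroup_def sym_inv_semigroup_def)
  then have "z = x" using z(2) fx by (metis domI inj_onD)
  then show ?thesis using g(1) z(1) by blast
qed

lemma orbit_sym:
  assumes "comm_inverse_subsemigroup X S" "y \<in> orbit S x"
  shows "x \<in> orbit S y"
  using assms comm_inverse_subsemigroup_inverse unfolding orbit_def by fastforce

lemma orbit_trans:
  assumes "comm_inverse_subsemigroup X S" "y \<in> orbit S x" "z \<in> orbit S y"
  shows "z \<in> orbit S x"
proof -
  have "(g \<circ>\<^sub>m f) x = Some z" if "f x = Some y" "g y = Some z" for f g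
    using that by simp
  then show ?thesis
    using assms comm_inverse_subsemigroup_comp[OF assms(1)] unfolding orbit_def by blast
qed

lemma orbit_rep_eq:
  assumes "comm_inverse_subsemigroup X S" "y \<in> orbit S x"
  shows "orbit_rep S y = orbit_rep S x"
proof -
  have "orbit S y = orbit S x"
    using orbit_trans[OF assms] orbit_trans[OF assms(1) orbit_sym[OF assms]] by blast
  then show ?thesis by (simp add: orbit_rep_def)
qed

text \<open>Each \<open>y\<close> is tested only against the representative of its own orbit. For
  \<open>f\<close> in \<open>S\<close> this loses nothing, because \<open>f\<close> never leaves an
  orbit, and the result is the set of all values of \<open>f\<close> at representatives.\<close>

definition rep_values :: "('a \<rightharpoonup> 'a) set \<Rightarrow> ('a \<rightharpoonup> 'a) \<Rightarrow> 'a set" where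
  "rep_values S f = {y. f (orbit_rep S y) = Some y}"

text \<open>Since \<open>f\<close> preserves orbits, its value at a representative, if defined, is
  the only point of \<open>rep_values S f\<close> in that orbit. Hence this set determines
  \<open>f\<close> at all representatives, including where \<open>f\<close> is undefined.\<close>

lemma rep_values_iff:
  assumes S: "comm_inverse_subsemigroup X S" and f: "f \<in> S"
  shows "f (orbit_rep S x) = Some y \<longleftrightarrow> y \<in> rep_values S f \<and> orbit_rep S y = orbit_rep S x"
proof
  assume fy: "f (orbit_rep S x) = Some y"
  then have "y \<in> orbit S (orbit_rep S x)" using f by (auto simp: orbit_def)
  then have "y \<in> orbit S x" by (rule orbit_trans[OF S orbit_rep_in_orbit])
  then have "orbit_rep S y = orbit_rep S x" by (rule orbit_rep_eq[OF S])
  then show "y \<in> rep_values S f \<and> orbit_rep S y = orbit_rep S x"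
    using fy by (simp add: rep_values_def)
qed (auto simp: rep_values_def)

lemma inj_on_rep_values:
  assumes S: "comm_inverse_subsemigroup X S"
  shows "inj_on (rep_values S) S"
proof (intro inj_onI ext)
  fix f g x assume f: "f \<in> S" and g: "g \<in> S" and eq: "rep_values S f = rep_values S g"
  let ?r = "orbit_rep S x"
  have "f ?r = Some y \<longleftrightarrow> g ?r = Some y" for y
    using rep_values_iff[OF S f] rep_values_iff[OF S g] eq by simp
  then have r: "f ?r = g ?r" by (metis option.exhaust)
  have "x \<in> orbit S ?r" by (rule orbit_sym[OF S orbit_rep_in_orbit])
  \<comment> \<open>The first case covers a representative that no element of \<open>S\<close> need
    map to itself.\<close>
  then consider "x = ?r" | h where "h \<in> S" "h ?r = Some x"
    by (auto simp: orbit_def)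
  then show "f x = g x"
  proof cases
    case 1
    then show ?thesis using r by simp
  next
    case 2
    \<comment> \<open>Commuting \<open>k\<close> past \<open>h\<close> gives
      \<open>k x = k (h r) = h (k r)\<close>, both sides being undefined when \<open>k r\<close> is.
      The same \<open>h\<close> serves for \<open>f\<close> and \<open>g\<close>, so agreement at
      \<open>r\<close> carries over to \<open>x\<close>.\<close>
    have "k x = (h \<circ>\<^sub>m k) ?r" if "k \<in> S" for k
      using fun_cong[OF comm_inverse_subsemigroup_comm[OF S 2(1) that], of ?r] 2(2) by simp
    from this[OF f] this[OF g] r show ?thesis by (simp add: map_comp_def)
  qed
qed

lemma rep_values_subset:
  assumes "comm_inverse_subsemigroup X S" "f \<in> S"
  shows "rep_values S f \<subseteq> X"
  using assms
  by (auto simp: rep_values_def comm_inverse_subsemigroup_def sym_inv_semigroup_def ran_def)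

lemma card_comm_inverse_subsemigroup_le:
  assumes "finite X" and S: "comm_inverse_subsemigroup X S"
  shows "card S \<le> 2 ^ card X"
proof -
  have "card S \<le> card (Pow X)"
    using assms rep_values_subset[OF S]
    by (intro card_inj_on_le[OF inj_on_rep_values[OF S]]) auto
  then show ?thesis by (simp add: card_Pow assms(1))
qed

lemma comm_inverse_subsemigroup_max_card:
  assumes fin: "finite X" and S: "comm_inverse_subsemigroup X S" and card: "card S = 2 ^ card X"
  shows "S = idempotents_on (\<circ>\<^sub>m) (sym_inv_semigroup X)" (is "_ = ?E")
proof -
  have "rep_values S ` S = Pow X"
  proof (rule card_subset_eq)
    show "finite (Pow X)" using fin by simp
    show "rep_values S ` S \<subseteq> Pow X" using rep_values_subset[OF S] by blast
    show "card (rep_values S ` S) = card (Pow X)"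
      by (simp add: card_image[OF inj_on_rep_values[OF S]] card card_Pow[OF fin])
  qed
  \<comment> \<open>Equality of cardinalities makes every subset of \<open>X\<close> a value set.
    For the \<open>f\<close> belonging to \<open>X\<close> itself, every point of \<open>X\<close>
    is the value of \<open>f\<close> at the representative of its orbit.\<close>
  then have "X \<in> rep_values S ` S" by simp
  then obtain f where f: "X = rep_values S f" by (rule imageE)
  have fixed: "y = x" if g: "g \<in> S" and gx: "g x = Some y" for g x y
  proof -
    have "x \<in> X" "y \<in> X"
      using g gx S by (auto simp: comm_inverse_subsemigroup_def sym_inv_semigroup_def ran_def)
    then have "f (orbit_rep S x) = Some x" "f (orbit_rep S y) = Some y"
      using f by (auto simp: rep_values_def)
    moreover have "y \<in> orbit S x" using g gx by (auto simp: orbit_def)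
    then have "orbit_rep S y = orbit_rep S x" by (rule orbit_rep_eq[OF S])
    \<comment> \<open>The representatives coincide, so \<open>x\<close> and \<open>y\<close> are the
      value of \<open>f\<close> at one and the same point.\<close>
    ultimately show "y = x" by simp
  qed
  have "g \<circ>\<^sub>m g = g" if "g \<in> S" for g
  proof
    show "(g \<circ>\<^sub>m g) x = g x" for x
      using fixed[OF that, of x] by (cases "g x") auto
  qed
  \<comment> \<open>Inclusion suffices, since \<open>S\<close> and the finite set of idempotents
    have the same cardinality.\<close>
  then have "S \<subseteq> ?E"
    using S by (auto simp: idempotents_on_def comm_inverse_subsemigroup_def)
  moreover have "card ?E = 2 ^ card X" by (rule card_idempotents_sym_inv_semigroup[OF fin])
  moreover have "finite ?E" using fin by (simp add: idempotents_sym_inv_semigroup)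
  ultimately show ?thesis using card by (intro card_subset_eq) auto
qed

theorem theorem3p2:
  fixes X :: "'a set" and n :: nat
  assumes "finite X" and "card X = n" and "n \<ge> 1"
  shows "(\<forall>S. comm_inverse_subsemigroup X S \<longrightarrow> card S \<le> 2 ^ n) \<and>
    (let E = idempotents_on (\<circ>\<^sub>m) (sym_inv_semigroup X) in
       (comm_inverse_subsemigroup X E \<and> card E = 2 ^ n) \<and>
       (\<forall>S. comm_inverse_subsemigroup X S \<and> card S = 2 ^ n \<longrightarrow> S = E))"
  using card_comm_inverse_subsemigroup_le[OF assms(1)] comm_inverse_subsemigroup_idempotents[of X]
    card_idempotents_sym_inv_semigroup[OF assms(1)] comm_inverse_subsemigroup_max_card[OF assms(1)]
  unfolding Let_def assms(2) by blast

end
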